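(* Let $k$ be a field and let $R$ be an integral domain that is finitely generated as a $k$-algebra. If $R$ is generically unit-additive, then $R$ is unit-additive.
   Context: A commutative ring is unit-additive if for all units $u,v$ of the ring, $u+v$ is a unit or nilpotent. An integral domain $R$ is generically unit-additive if there is some nonzero element $a\in R$ such that the localization $R_a=R[1/a]$ is unit-additive. *)

theory Defs
  imports "HOL-Algebra.Algebra"
begin

definition nilpotent :: "('a, 'm) ring_scheme \<Rightarrow> 'a \<Rightarrow> bool" where
  "nilpotent R x \<longleftrightarrow> x \<in> carrier R \<and> (\<exists>n::nat. n > 0 \<and> x [^]\<^bsub>R\<^esub> n = \<zero>\<^bsub>R\<^esub>)"

definition unit_additive :: "('a, 'm) ring_scheme \<Rightarrow> bool" where
  "unit_additive R \<longleftrightarrow>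
     cring R \<and> (\<forall>u\<in>Units R. \<forall>v\<in>Units R. u \<oplus>\<^bsub>R\<^esub> v \<in> Units R \<or> nilpotent R (u \<oplus>\<^bsub>R\<^esub> v))"

text \<open>
  Localization of a commutative ring at a multiplicative set \<open>S\<close>: fractions are equivalence
  classes of pairs (numerator, denominator). The extra factor \<open>t\<close> in the relation
  is needed for transitivity when \<open>S\<close> contains zero divisors.
\<close>

definition frac_rel :: "('a, 'm) ring_scheme \<Rightarrow> 'a set \<Rightarrow> (('a \<times> 'a) \<times> ('a \<times> 'a)) set" where
  "frac_rel R S = {((r, s), (r', s')). r \<in> carrier R \<and> s \<in> S \<and> r' \<in> carrier R \<and> s' \<in> S \<and>
     (\<exists>t\<in>S. t \<otimes>\<^bsub>R\<^esub> (r \<otimes>\<^bsub>R\<^esub> s') = t \<otimes>\<^bsub>R\<^esub> (r' \<otimes>\<^bsub>R\<^esub> s))}"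

definition loc_frac :: "('a, 'm) ring_scheme \<Rightarrow> 'a set \<Rightarrow> 'a \<Rightarrow> 'a \<Rightarrow> ('a \<times> 'a) set" where
  "loc_frac R S r s = frac_rel R S `` {(r, s)}"

text \<open>
  The operations are the usual ones on representatives. The union runs over all choices of
  representatives; as they all give the same fraction, it equals that fraction
  (see \<open>frac_mult\<close> and \<open>frac_add\<close> below).
\<close>

definition localization :: "('a, 'm) ring_scheme \<Rightarrow> 'a set \<Rightarrow> ('a \<times> 'a) set ring" where
  "localization R S =
     \<lparr> partial_object.carrier = (carrier R \<times> S) // frac_rel R S,
       monoid.mult = (\<lambda>P Q. \<Union>(r, s)\<in>P. \<Union>(r', s')\<in>Q. loc_frac R S (r \<otimes>\<^bsub>R\<^esub> r') (s \<otimes>\<^bsub>R\<^esub> s')),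
       monoid.one = loc_frac R S \<one>\<^bsub>R\<^esub> \<one>\<^bsub>R\<^esub>,
       ring.zero = loc_frac R S \<zero>\<^bsub>R\<^esub> \<one>\<^bsub>R\<^esub>,
       ring.add = (\<lambda>P Q. \<Union>(r, s)\<in>P. \<Union>(r', s')\<in>Q.
                loc_frac R S (r \<otimes>\<^bsub>R\<^esub> s' \<oplus>\<^bsub>R\<^esub> r' \<otimes>\<^bsub>R\<^esub> s) (s \<otimes>\<^bsub>R\<^esub> s')) \<rparr>"

definition localization_at_elem :: "('a, 'm) ring_scheme \<Rightarrow> 'a \<Rightarrow> ('a \<times> 'a) set ring" where
  "localization_at_elem R a = localization R {a [^]\<^bsub>R\<^esub> n |n::nat. True}"

definition generically_unit_additive :: "('a, 'm) ring_scheme \<Rightarrow> bool" where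
  "generically_unit_additive R \<longleftrightarrow>
     domain R \<and> (\<exists>a\<in>carrier R - {\<zero>\<^bsub>R\<^esub>}. unit_additive (localization_at_elem R a))"

text \<open>
  The \<open>k\<close>-subalgebra of \<open>A\<close> generated by \<open>G\<close> is the subring generated by \<open>G\<close> together with the
  image of the structure map \<open>k \<rightarrow> A\<close>, \<open>c \<mapsto> c \<odot> \<one>\<close>.
\<close>

definition finitely_generated_algebra ::
  "('k, 'l) ring_scheme \<Rightarrow> ('k, 'a, 'm) module_scheme \<Rightarrow> bool" where
  "finitely_generated_algebra k A \<longleftrightarrow>
     algebra k A \<and>
     (\<exists>G. finite G \<and> G \<subseteq> carrier A \<and>
        generate_ring A ((\<lambda>c. c \<odot>\<^bsub>A\<^esub> \<one>\<^bsub>A\<^esub>) ` carrier k \<union> G) = carrier A)"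

locale multiplicative_set = cring R for R :: "('a, 'm) ring_scheme" (structure) +
  fixes S :: "'a set"
  assumes S_sub: "S \<subseteq> carrier R"
    and S_one: "\<one> \<in> S"
    and S_mult: "\<lbrakk>s \<in> S; t \<in> S\<rbrakk> \<Longrightarrow> s \<otimes> t \<in> S"
begin

lemma S_carr [simp, intro]: "s \<in> S \<Longrightarrow> s \<in> carrier R"
  using S_sub by auto

lemma frac_rel_equiv: "equiv (carrier R \<times> S) (frac_rel R S)"
proof (rule equivI)
  show "frac_rel R S \<subseteq> (carrier R \<times> S) \<times> (carrier R \<times> S)"
    by (auto simp: frac_rel_def)
  show "refl_on (carrier R \<times> S) (frac_rel R S)"
    using S_one by (auto simp: refl_on_def frac_rel_def)
  show "sym (frac_rel R S)"
    by (force simp: sym_def frac_rel_def)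
  show "trans (frac_rel R S)"
  proof (rule transI)
    fix x y z assume a: "(x, y) \<in> frac_rel R S" "(y, z) \<in> frac_rel R S"
    obtain r s r' s' r'' s'' where e: "x = (r, s)" "y = (r', s')" "z = (r'', s'')"
      by (cases x, cases y, cases z)
    obtain t u where
      c: "r \<in> carrier R" "s \<in> S" "r' \<in> carrier R" "s' \<in> S" "r'' \<in> carrier R" "s'' \<in> S" "t \<in> S" "u \<in> S"
      and t: "t \<otimes> (r \<otimes> s') = t \<otimes> (r' \<otimes> s)" and u: "u \<otimes> (r' \<otimes> s'') = u \<otimes> (r'' \<otimes> s')"
      using a unfolding e frac_rel_def by auto
    have cc: "s \<in> carrier R" "s' \<in> carrier R" "s'' \<in> carrier R" "t \<in> carrier R" "u \<in> carrier R"
      using c by auto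
    have "(t \<otimes> u \<otimes> s') \<otimes> (r \<otimes> s'') = (u \<otimes> s'') \<otimes> (t \<otimes> (r \<otimes> s'))"
      using c(1,3,5) cc by (simp add: m_ac)
    also have "\<dots> = (t \<otimes> s) \<otimes> (u \<otimes> (r' \<otimes> s''))"
      unfolding t using c(1,3,5) cc by (simp add: m_ac)
    also have "\<dots> = (t \<otimes> u \<otimes> s') \<otimes> (r'' \<otimes> s)"
      unfolding u using c(1,3,5) cc by (simp add: m_ac)
    finally show "(x, z) \<in> frac_rel R S"
      unfolding e frac_rel_def using c S_mult by blast
  qed
qed

lemma frac_eq_iff:
  assumes "r \<in> carrier R" "s \<in> S" "r' \<in> carrier R" "s' \<in> S"
  shows "loc_frac R S r s = loc_frac R S r' s' \<longleftrightarrow> (\<exists>t\<in>S. t \<otimes> (r \<otimes> s') = t \<otimes> (r' \<otimes> s))"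
proof -
  have "loc_frac R S r s = loc_frac R S r' s' \<longleftrightarrow> ((r, s), (r', s')) \<in> frac_rel R S"
    unfolding loc_frac_def using assms by (intro eq_equiv_class_iff[OF frac_rel_equiv]) auto
  then show ?thesis using assms by (simp add: frac_rel_def)
qed

lemma frac_in [simp, intro]:
  "r \<in> carrier R \<Longrightarrow> s \<in> S \<Longrightarrow> loc_frac R S r s \<in> carrier (localization R S)"
  by (auto simp: localization_def loc_frac_def intro: quotientI)

lemma frac_cases:
  assumes "P \<in> carrier (localization R S)"
  obtains r s where "r \<in> carrier R" "s \<in> S" "P = loc_frac R S r s"
  using assms by (auto simp: localization_def loc_frac_def elim!: quotientE)

lemma frac_one: "\<one>\<^bsub>localization R S\<^esub> = loc_frac R S \<one> \<one>"
  and frac_zero: "\<zero>\<^bsub>localization R S\<^esub> = loc_frac R S \<zero> \<one>"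
  by (simp_all add: localization_def)

lemma UN_frac:
  assumes "r \<in> carrier R" "s \<in> S" "r' \<in> carrier R" "s' \<in> S"
    and *: "\<And>x y x' y'. \<lbrakk>x \<in> carrier R; y \<in> S; x' \<in> carrier R; y' \<in> S;
        loc_frac R S x y = loc_frac R S r s; loc_frac R S x' y' = loc_frac R S r' s'\<rbrakk> \<Longrightarrow> f x y x' y' = T"
  shows "(\<Union>(x, y)\<in>loc_frac R S r s. \<Union>(x', y')\<in>loc_frac R S r' s'. f x y x' y') = T"
proof -
  have mem: "x \<in> carrier R" "y \<in> S" "loc_frac R S x y = loc_frac R S p q"
    if "(x, y) \<in> loc_frac R S p q" for x y p q
  proof -
    have "((p, q), (x, y)) \<in> frac_rel R S"
      using that by (simp add: loc_frac_def)
    then show "x \<in> carrier R" "y \<in> S" "loc_frac R S x y = loc_frac R S p q"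
      using equiv_class_eq[OF frac_rel_equiv, of "(p, q)" "(x, y)"]
      by (simp_all add: loc_frac_def frac_rel_def)
  qed
  have self: "(p, q) \<in> loc_frac R S p q" if "p \<in> carrier R" "q \<in> S" for p q
    using that equiv_class_self[OF frac_rel_equiv, of "(p, q)"] by (simp add: loc_frac_def)
  have f: "f x y x' y' = T" if "(x, y) \<in> loc_frac R S r s" "(x', y') \<in> loc_frac R S r' s'" for x y x' y'
    by (rule *[OF mem(1,2)[OF that(1)] mem(1,2)[OF that(2)] mem(3)[OF that(1)] mem(3)[OF that(2)]])
  have inner: "(\<Union>(x', y')\<in>loc_frac R S r' s'. f x y x' y') = T" if "(x, y) \<in> loc_frac R S r s" for x y
    using f[OF that] self[OF assms(3,4)] by (intro SUP_eq_const) auto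
  show ?thesis
  proof (rule SUP_eq_const)
    show "loc_frac R S r s \<noteq> {}"
      using self[OF assms(1,2)] by blast
    fix z assume "z \<in> loc_frac R S r s"
    then show "(case z of (x, y) \<Rightarrow> \<Union>(x', y')\<in>loc_frac R S r' s'. f x y x' y') = T"
      by (cases z) (simp only: split_conv inner)
  qed
qed

lemma frac_mult:
  assumes "r \<in> carrier R" "s \<in> S" "r' \<in> carrier R" "s' \<in> S"
  shows "loc_frac R S r s \<otimes>\<^bsub>localization R S\<^esub> loc_frac R S r' s' = loc_frac R S (r \<otimes> r') (s \<otimes> s')"
proof -
  have "loc_frac R S (x \<otimes> x') (y \<otimes> y') = loc_frac R S (r \<otimes> r') (s \<otimes> s')"
    if h: "x \<in> carrier R" "y \<in> S" "x' \<in> carrier R" "y' \<in> S"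
      "loc_frac R S x y = loc_frac R S r s" "loc_frac R S x' y' = loc_frac R S r' s'" for x y x' y'
  proof -
    obtain t u where tu: "t \<in> S" "u \<in> S" "t \<otimes> (x \<otimes> s) = t \<otimes> (r \<otimes> y)" "u \<otimes> (x' \<otimes> s') = u \<otimes> (r' \<otimes> y')"
      using h assms by (auto simp: frac_eq_iff)
    have "(t \<otimes> u) \<otimes> ((x \<otimes> x') \<otimes> (s \<otimes> s')) = (t \<otimes> (x \<otimes> s)) \<otimes> (u \<otimes> (x' \<otimes> s'))"
      using h assms tu(1,2) by (simp add: m_ac)
    also have "\<dots> = (t \<otimes> u) \<otimes> ((r \<otimes> r') \<otimes> (y \<otimes> y'))"
      unfolding tu using h assms tu(1,2) by (simp add: m_ac)
    finally show ?thesis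
      using h(1-4) assms tu(1,2) S_mult by (subst frac_eq_iff) blast+
  qed
  then show ?thesis
    unfolding localization_def monoid.simps ring.simps by (rule UN_frac[OF assms])
qed

lemma frac_add:
  assumes "r \<in> carrier R" "s \<in> S" "r' \<in> carrier R" "s' \<in> S"
  shows "loc_frac R S r s \<oplus>\<^bsub>localization R S\<^esub> loc_frac R S r' s' = loc_frac R S (r \<otimes> s' \<oplus> r' \<otimes> s) (s \<otimes> s')"
proof -
  have "loc_frac R S (x \<otimes> y' \<oplus> x' \<otimes> y) (y \<otimes> y') = loc_frac R S (r \<otimes> s' \<oplus> r' \<otimes> s) (s \<otimes> s')"
    if h: "x \<in> carrier R" "y \<in> S" "x' \<in> carrier R" "y' \<in> S"
      "loc_frac R S x y = loc_frac R S r s" "loc_frac R S x' y' = loc_frac R S r' s'" for x y x' y'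
  proof -
    obtain t u where tu: "t \<in> S" "u \<in> S" "t \<otimes> (x \<otimes> s) = t \<otimes> (r \<otimes> y)" "u \<otimes> (x' \<otimes> s') = u \<otimes> (r' \<otimes> y')"
      using h assms by (auto simp: frac_eq_iff)
    have "(t \<otimes> u) \<otimes> ((x \<otimes> y' \<oplus> x' \<otimes> y) \<otimes> (s \<otimes> s'))
        = (t \<otimes> (x \<otimes> s)) \<otimes> (u \<otimes> (y' \<otimes> s')) \<oplus> (u \<otimes> (x' \<otimes> s')) \<otimes> (t \<otimes> (y \<otimes> s))"
      using h assms tu(1,2) by (simp add: m_ac l_distr r_distr)
    also have "\<dots> = (t \<otimes> u) \<otimes> ((r \<otimes> s' \<oplus> r' \<otimes> s) \<otimes> (y \<otimes> y'))"
      unfolding tu using h assms tu(1,2) by (simp add: m_ac l_distr r_distr)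
    finally show ?thesis
      using h(1-4) assms tu(1,2) S_mult by (subst frac_eq_iff) (blast | simp)+
  qed
  then show ?thesis
    unfolding localization_def monoid.simps ring.simps by (rule UN_frac[OF assms])
qed

lemma frac_eqI:
  "\<lbrakk>r \<otimes> s' = r' \<otimes> s; r \<in> carrier R; s \<in> S; r' \<in> carrier R; s' \<in> S\<rbrakk> \<Longrightarrow> loc_frac R S r s = loc_frac R S r' s'"
  using S_one by (auto simp: frac_eq_iff)

theorem localization_cring: "cring (localization R S)" (is "cring ?L")
proof (rule cringI)
  note simps = frac_one frac_zero frac_add frac_mult S_one S_mult
  show "abelian_group ?L"
  proof (rule abelian_groupI)
    fix P Q assume "P \<in> carrier ?L" "Q \<in> carrier ?L"
    then show "P \<oplus>\<^bsub>?L\<^esub> Q \<in> carrier ?L" "P \<oplus>\<^bsub>?L\<^esub> Q = Q \<oplus>\<^bsub>?L\<^esub> P"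
      by (auto elim!: frac_cases simp: simps a_comm m_comm)
  next
    show "\<zero>\<^bsub>?L\<^esub> \<in> carrier ?L" by (simp add: simps)
  next
    fix P Q T assume "P \<in> carrier ?L" "Q \<in> carrier ?L" "T \<in> carrier ?L"
    then show "P \<oplus>\<^bsub>?L\<^esub> Q \<oplus>\<^bsub>?L\<^esub> T = P \<oplus>\<^bsub>?L\<^esub> (Q \<oplus>\<^bsub>?L\<^esub> T)"
      by (auto elim!: frac_cases simp: simps m_ac a_ac l_distr r_distr)
  next
    fix P assume "P \<in> carrier ?L"
    then obtain r s where P: "r \<in> carrier R" "s \<in> S" "P = loc_frac R S r s" by (rule frac_cases)
    then show "\<zero>\<^bsub>?L\<^esub> \<oplus>\<^bsub>?L\<^esub> P = P" by (simp add: simps)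
    have "loc_frac R S (\<ominus> r) s \<oplus>\<^bsub>?L\<^esub> P = \<zero>\<^bsub>?L\<^esub>"
      using P by (simp add: simps) (rule frac_eqI, simp_all add: simps l_minus l_neg)
    then show "\<exists>Q\<in>carrier ?L. Q \<oplus>\<^bsub>?L\<^esub> P = \<zero>\<^bsub>?L\<^esub>" using P by blast
  qed
  show "comm_monoid ?L"
    by (rule comm_monoidI) (auto elim!: frac_cases simp: simps m_ac)
  fix P Q T assume "P \<in> carrier ?L" "Q \<in> carrier ?L" "T \<in> carrier ?L"
  then obtain r s r' s' r'' s'' where
    c: "r \<in> carrier R" "s \<in> S" "r' \<in> carrier R" "s' \<in> S" "r'' \<in> carrier R" "s'' \<in> S"
    and e: "P = loc_frac R S r s" "Q = loc_frac R S r' s'" "T = loc_frac R S r'' s''"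
    by (elim frac_cases)
  show "(P \<oplus>\<^bsub>?L\<^esub> Q) \<otimes>\<^bsub>?L\<^esub> T = P \<otimes>\<^bsub>?L\<^esub> T \<oplus>\<^bsub>?L\<^esub> Q \<otimes>\<^bsub>?L\<^esub> T"
    unfolding e using c by (simp add: simps, intro frac_eqI) (simp_all add: simps m_ac l_distr r_distr)
qed

end

lemma (in cring) multiplicative_set_powers:
  assumes "a \<in> carrier R"
  shows "multiplicative_set R {a [^] n |n::nat. True}"
proof unfold_locales
  show "\<one> \<in> {a [^] n |n::nat. True}"
    by (metis (mono_tags) mem_Collect_eq nat_pow_0)
qed (use assms nat_pow_mult in auto)

corollary (in cring) localization_at_elem_cring:
  "a \<in> carrier R \<Longrightarrow> cring (localization_at_elem R a)"
  unfolding localization_at_elem_def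
  by (rule multiplicative_set.localization_cring[OF multiplicative_set_powers])

end

(*
If the localization R_a is unit-additive, its units together with 0 form a field containing k
and a, so every nonzero element of k[a] divides a power of a in R. This "divides a power of a
fixed nonzero element" property descends along each generator, from B[x] to B: when x is
transcendental over B, compare leading coefficients; when x is algebraic of degree m, multiply by
powers of the leading coefficient of a minimal equation and use that 1, x, ..., x^(m-1) are
linearly independent over B. So there is a nonzero c in k[a] such that every nonzero element of
k[a] divides a power of c in k[a]. If a were transcendental over k, then 1 + a c would divide a
power of c while being comaximal with c, and hence be a nonconstant unit of a polynomial ring.
So a is algebraic over k and already invertible in R.
*)

theory Submission
  imports Defs
begin

section \<open>Divisors of powers, evaluation of coefficient lists, pseudo-division\<close>

text \<open>For \<open>B\<close> the carrier of a domain and \<open>s\<close> nonzero, these are the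
  \<open>b\<close> in \<open>B\<close> that become units in the localization at \<open>s\<close>.
  The cofactor has to lie in \<open>B\<close>, so the notion depends on the subring; the descent
  lemmas control this dependence.\<close>

definition (in ring) divides_power :: "'a set \<Rightarrow> 'a \<Rightarrow> 'a \<Rightarrow> bool" where
  "divides_power B s b \<longleftrightarrow> (\<exists>n::nat. \<exists>g\<in>B. b \<otimes> g = s [^] n)"

lemma (in ring) subring_nat_pow_closed:
  assumes "subring K R" "x \<in> K"
  shows "x [^] (n::nat) \<in> K"
  using assms subringE(3,6)[OF assms(1)] by (induction n) auto

lemma (in domain) nat_pow_nonzero:
  assumes "x \<in> carrier R" "x \<noteq> \<zero>"
  shows "x [^] (n::nat) \<noteq> \<zero>"
  using assms by (induction n) (auto simp: integral_iff)

lemma (in ring) normalize_eq_NilD: "normalize p = [] \<Longrightarrow> set p \<subseteq> {\<zero>}"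
  by (induction p) (auto split: if_splits)

lemma (in ring) eval_in_simple_extension:
  assumes "subring K R" "x \<in> carrier R" "set p \<subseteq> K"
  shows "eval p x \<in> simple_extension K x"
proof -
  have "normalize p \<in> carrier (K[X])"
    using normalize_gives_polynomial[OF assms(3)] univ_poly_carrier by blast
  moreover have "eval (normalize p) x = eval p x"
    using eval_normalize assms subringE(1) by blast
  ultimately show ?thesis
    using simple_extension_as_eval_img[OF subringE(1)[OF assms(1)] assms(2)] by (metis imageI)
qed

lemma (in ring) simple_extensionE:
  assumes "subring K R" "x \<in> carrier R" "y \<in> simple_extension K x"
  obtains p where "polynomial K p" "y = eval p x"
  using assms simple_extension_as_eval_img[OF subringE(1)[OF assms(1)] assms(2)] univ_poly_carrier
  by blast

lemma (in cring) eval_map_mult: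
  assumes "set p \<subseteq> carrier R" "c \<in> carrier R" "x \<in> carrier R"
  shows "eval (map ((\<otimes>) c) p) x = c \<otimes> eval p x"
  using assms(1)
proof (induction p)
  case (Cons a p)
  then have "eval p x \<in> carrier R" using eval_in_carrier assms(3) by auto
  then show ?case using Cons assms by (simp add: m_assoc r_distr)
qed (use assms in simp)

text \<open>Serves the elimination step of pseudo-division: in lists of equal length, matching
  entries belong to the same power of \<open>x\<close>.\<close>

lemma (in cring) eval_map2_diff:
  assumes "length p = length q" "set p \<subseteq> carrier R" "set q \<subseteq> carrier R"
    and "c \<in> carrier R" "d \<in> carrier R" "x \<in> carrier R"
  shows "eval (map2 (\<lambda>u v. c \<otimes> u \<ominus> d \<otimes> v) p q) x = c \<otimes> eval p x \<ominus> d \<otimes> eval q x"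
  using assms(1-3)
proof (induction p q rule: list_induct2)
  case Nil
  then show ?case using assms by (simp add: minus_eq)
next
  case (Cons u p v q)
  have c: "u \<in> carrier R" "v \<in> carrier R" "eval p x \<in> carrier R" "eval q x \<in> carrier R"
    "x [^] length q \<in> carrier R"
    using Cons.prems eval_in_carrier assms(6) by auto
  have "eval (map2 (\<lambda>u v. c \<otimes> u \<ominus> d \<otimes> v) (u # p) (v # q)) x
      = (c \<otimes> u \<ominus> d \<otimes> v) \<otimes> x [^] length q \<oplus> (c \<otimes> eval p x \<ominus> d \<otimes> eval q x)"
    using Cons by simp
  also have "\<dots> = c \<otimes> (u \<otimes> x [^] length q \<oplus> eval p x) \<ominus> d \<otimes> (v \<otimes> x [^] length q \<oplus> eval q x)"
    using c assms(4,5) by algebra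
  finally show ?case using Cons.hyps by simp
qed

text \<open>
  Coefficient lists have their leading entry first and need not be normalized, so the remainder
  may start with zeros. The divisor is the list \<open>e # t\<close>.
\<close>

lemma (in domain) pseudo_division:
  assumes K: "subring K R" and e: "e \<in> K" "e \<noteq> \<zero>" and t: "set t \<subseteq> K"
    and x: "x \<in> carrier R" and p: "set p \<subseteq> K"
  obtains N :: nat and q r where "set q \<subseteq> K" "set r \<subseteq> K"
    "length r = min (length p) (length t)" "length q = length p - length t"
    "e [^] N \<otimes> eval p x = eval q x \<otimes> eval (e # t) x \<oplus> eval r x"
    "hd p \<noteq> \<zero> \<Longrightarrow> q \<noteq> [] \<Longrightarrow> hd q \<noteq> \<zero>"
proof -
  note sub = subringE[OF K]
  have carr: "\<And>v. v \<in> K \<Longrightarrow> v \<in> carrier R" using sub(1) by blast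
  have setcarr: "\<And>v. set v \<subseteq> K \<Longrightarrow> set v \<subseteq> carrier R" using sub(1) by blast
  note ev = eval_in_carrier[OF setcarr x]
  note powK = subring_nat_pow_closed[OF K e(1)]
  \<comment> \<open>The clause for \<open>q = []\<close> records that nothing is scaled before the
    quotient starts. The first quotient entry, when formed, is then the leading entry of the
    dividend, as the claim on \<open>hd q\<close> needs.\<close>
  have "\<exists>(N::nat) q r. set q \<subseteq> K \<and> set r \<subseteq> K \<and>
      length r = min (length p) (length t) \<and> length q = length p - length t \<and>
      e [^] N \<otimes> eval p x = eval q x \<otimes> eval (e # t) x \<oplus> eval r x \<and>
      (q = [] \<longrightarrow> N = 0 \<and> r = p) \<and> (hd p \<noteq> \<zero> \<longrightarrow> q \<noteq> [] \<longrightarrow> hd q \<noteq> \<zero>)"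
    using p
  \<comment> \<open>Horner's rule: appending \<open>a\<close> turns \<open>eval p x\<close> into
    \<open>eval p x \<otimes> x \<oplus> a\<close>, so the dividend is read from its leading
    end.\<close>
  proof (induction p rule: rev_induct)
    case Nil
    show ?case
      by (rule exI[of _ 0], rule exI[of _ "[]"], rule exI[of _ "[]"]) (use ev t e carr x in auto)
  next
    case (snoc a p)
    then have a: "a \<in> K" and p: "set p \<subseteq> K" by auto
    show ?case
    proof (cases "length p < length t")
      case True
      have "eval (p @ [a]) x \<in> carrier R" "eval (e # t) x \<in> carrier R"
        using ev snoc.prems e t by (simp_all del: eval.simps)
      then show ?thesis
        by (intro exI[of _ 0] exI[of _ "[]"] exI[of _ "p @ [a]"]) (use True snoc.prems in simp)
    next
      case False
      from snoc.IH[OF p] obtain N :: nat and q r where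
        q: "set q \<subseteq> K" and r: "set r \<subseteq> K" and lr: "length r = length t"
        and lq: "length q = length p - length t"
        and eq: "e [^] N \<otimes> eval p x = eval q x \<otimes> eval (e # t) x \<oplus> eval r x"
        and q0: "q = [] \<Longrightarrow> N = 0 \<and> r = p" and hq: "hd p \<noteq> \<zero> \<Longrightarrow> q \<noteq> [] \<Longrightarrow> hd q \<noteq> \<zero>"
        using False by (metis (no_types, lifting) leI min.absorb2)
      \<comment> \<open>Multiplying the division of \<open>p\<close> by \<open>x\<close> and adding
        \<open>e [^] N \<otimes> a\<close> leaves \<open>r @ [a']\<close>, one entry too long for a
        remainder. Its leading entry \<open>l\<close> becomes the next quotient entry.\<close>
      define a' where "a' = e [^] N \<otimes> a"
      have a': "a' \<in> K" using powK a sub by (simp add: a'_def)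
      obtain l r' where lr': "r @ [a'] = l # r'" by (cases "r @ [a']") auto
      then have len': "length r' = length t" using lr by (metis length_append_singleton length_Cons nat.inject)
      have lK: "l \<in> K" "set r' \<subseteq> K" using lr' r a' by (metis Un_iff empty_subsetI insert_subset le_sup_iff list.set(1) list.simps(15) set_append)+
      \<comment> \<open>After scaling by \<open>e\<close>, subtracting \<open>l\<close> times the
        divisor \<open>e # t\<close> cancels the excess term; only the tails \<open>r'\<close> and
        \<open>t\<close> remain.\<close>
      define s where "s = map2 (\<lambda>u v. e \<otimes> u \<ominus> l \<otimes> v) r' t"
      have sK: "set s \<subseteq> K"
        using lK t e unfolding s_def a_minus_def
        by (auto intro!: sub(5-7) dest: set_zip_leftD set_zip_rightD)
      let ?q = "map ((\<otimes>) e) q @ [l]"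
      have qK: "set ?q \<subseteq> K" using q e sub lK by auto
      have es: "eval s x = e \<otimes> eval r' x \<ominus> l \<otimes> eval t x"
        unfolding s_def by (rule eval_map2_diff) (use len' lK t e carr x in auto)
      have eqq: "eval ?q x = e \<otimes> eval q x \<otimes> x \<oplus> l"
        using eval_append_aux[of "map ((\<otimes>) e) q" l x] eval_map_mult[OF setcarr[OF q] carr[OF e(1)] x] qK lK x carr
        by auto
      have ep: "eval (p @ [a]) x = eval p x \<otimes> x \<oplus> a"
        using eval_append_aux p a x carr by blast
      have er: "eval r x \<otimes> x \<oplus> a' = l \<otimes> x [^] length t \<oplus> eval r' x"
        using eval_append_aux[of r a' x] setcarr[OF r] carr[OF a'] x unfolding lr' by (simp add: len')
      have et: "eval (e # t) x = e \<otimes> x [^] length t \<oplus> eval t x" by simp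
      define S Q Rr P T y where "S = eval (e # t) x" and "Q = eval q x" and "Rr = eval r x"
        and "P = eval p x" and "T = eval t x" and "y = x [^] length t"
      define R' E where "R' = eval r' x" and "E = e [^] N"
      have c: "S \<in> carrier R" "Q \<in> carrier R" "Rr \<in> carrier R" "P \<in> carrier R" "T \<in> carrier R"
        "y \<in> carrier R" "R' \<in> carrier R" "E \<in> carrier R" "a \<in> carrier R" "l \<in> carrier R" "e \<in> carrier R"
        using ev[of "e # t"] ev q r p t e lK a x powK carr
        by (simp_all add: S_def Q_def Rr_def P_def T_def y_def R'_def E_def del: eval.simps)
      have h1: "E \<otimes> P = Q \<otimes> S \<oplus> Rr" using eq by (simp only: S_def Q_def Rr_def P_def E_def)
      have h2: "Rr \<otimes> x \<oplus> E \<otimes> a = l \<otimes> y \<oplus> R'" using er by (simp only: a'_def Rr_def E_def y_def R'_def)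
      have h3: "S = e \<otimes> y \<oplus> T" using et by (simp only: S_def y_def T_def)
      have "e [^] Suc N \<otimes> eval (p @ [a]) x = E \<otimes> e \<otimes> (P \<otimes> x \<oplus> a)"
        by (simp add: ep E_def P_def del: eval.simps)
      also have "\<dots> = e \<otimes> ((E \<otimes> P) \<otimes> x \<oplus> E \<otimes> a)"
        using c x by algebra
      also have "\<dots> = e \<otimes> (Q \<otimes> S \<otimes> x \<oplus> (Rr \<otimes> x \<oplus> E \<otimes> a))"
        unfolding h1 using c x by algebra
      also have "\<dots> = (e \<otimes> Q \<otimes> x \<oplus> l) \<otimes> S \<oplus> (e \<otimes> R' \<ominus> l \<otimes> T)"
        unfolding h2 h3 using c x by algebra
      finally have fin: "e [^] Suc N \<otimes> eval (p @ [a]) x = eval ?q x \<otimes> eval (e # t) x \<oplus> eval s x"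
        by (simp only: eqq es S_def Q_def R'_def T_def)
      have hd: "hd ?q \<noteq> \<zero>" if h: "hd (p @ [a]) \<noteq> \<zero>"
      proof (cases "q = []")
        case True
        then have "l = hd (p @ [a])" using q0[OF True] lr' carr[OF a] by (simp add: a'_def)
        then show ?thesis using True h by simp
      next
        case False
        then have "p \<noteq> []" using lq by auto
        then have "hd q \<noteq> \<zero>" using hq h False by simp
        then show ?thesis using False e q carr
          by (cases q) (auto simp: integral_iff)
      qed
      have lens: "length s = min (length (p @ [a])) (length t)" "length ?q = length (p @ [a]) - length t"
        using False lq len' by (auto simp: s_def)
      show ?thesis
        by (rule exI[of _ "Suc N"], rule exI[of _ ?q], rule exI[of _ s])
          (intro conjI impI fin lens qK sK hd, simp_all)
    qed
  qed
  then show thesis using that by blast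
qed


section \<open>Descent of divisors of powers from \<open>B[x]\<close> to \<open>B\<close>\<close>

lemma (in domain) lead_coeff_pow:
  assumes K: "subring K R" and p: "p \<in> carrier (K[X])" "p \<noteq> []"
  shows "p [^]\<^bsub>K[X]\<^esub> (n::nat) \<noteq> [] \<and> hd (p [^]\<^bsub>K[X]\<^esub> n) = hd p [^] n"
proof -
  interpret UP: domain "K[X]" by (rule univ_poly_is_domain[OF K])
  show ?thesis
  proof (induction n)
    case 0
    then show ?case by (simp add: univ_poly_one)
  next
    case (Suc n)
    have "p [^]\<^bsub>K[X]\<^esub> n \<in> carrier (K[X])" using p by simp
    then show ?case
      using Suc p poly_mult_lead_coeff[OF K, of "p [^]\<^bsub>K[X]\<^esub> n" p]
        poly_mult_integral[OF K, of "p [^]\<^bsub>K[X]\<^esub> n" p]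
      by (auto simp: univ_poly_carrier univ_poly_mult)
  qed
qed

text \<open>Evaluation at \<open>x\<close> is injective, so an equation
  \<open>b \<otimes> f = s [^] n\<close> lifts to polynomials. Leading coefficients multiply, so
  \<open>b\<close> divides a power of the leading coefficient of \<open>S\<close>, which serves as
  \<open>c\<close> for every \<open>b\<close>.\<close>

lemma (in domain) power_divisors_descend_transcendental:
  assumes B: "subring B R" and x: "x \<in> carrier R" and tr: "(transcendental over B) x"
    and s: "s \<in> simple_extension B x" "s \<noteq> \<zero>"
  shows "\<exists>c\<in>B - {\<zero>}. \<forall>b\<in>B. divides_power (simple_extension B x) s b \<longrightarrow> divides_power B c b"
proof -
  interpret H: ring_hom_cring "B[X]" R "\<lambda>p. eval p x" by (rule eval_cring_hom[OF B x])
  obtain S where S: "polynomial B S" "s = eval S x" using simple_extensionE[OF B x s(1)] .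
  have S0: "S \<noteq> []" using S s by auto
  have SU: "S \<in> carrier (B[X])" using S univ_poly_carrier by blast
  have inj: "inj_on (\<lambda>p. eval p x) (carrier (B[X]))"
    using tr by (simp add: over_def transcendental_def)
  have hdB: "hd p \<in> B" if "polynomial B p" "p \<noteq> []" for p
    using that by (auto simp: polynomial_def)
  show ?thesis
  proof (rule bexI[of _ "hd S"], intro ballI impI)
    show "hd S \<in> B - {\<zero>}" using S S0 by (auto simp: polynomial_def)
    fix b assume b: "b \<in> B" "divides_power (simple_extension B x) s b"
    then obtain n :: nat and f where f: "f \<in> simple_extension B x" "b \<otimes> f = s [^] n"
      by (auto simp: divides_power_def)
    obtain F where F: "polynomial B F" "f = eval F x" using simple_extensionE[OF B x f(1)] .
    have sc: "s \<in> carrier R" using s simple_extension_in_carrier[OF subringE(1)[OF B] x] by blast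
    have bc: "b \<in> carrier R" using b subringE(1)[OF B] by blast
    have sn: "s [^] n \<noteq> \<zero>" by (rule nat_pow_nonzero[OF sc s(2)])
    have fc: "f \<in> carrier R" using f simple_extension_in_carrier[OF subringE(1)[OF B] x] by blast
    \<comment> \<open>The list \<open>[b]\<close> is a normalized polynomial only for nonzero
      \<open>b\<close>.\<close>
    have b0: "b \<noteq> \<zero>" using f sn fc by auto
    have F0: "F \<noteq> []" using F f sn bc by auto
    have bU: "[b] \<in> carrier (B[X])" "polynomial B [b]"
      using b b0 by (auto simp: polynomial_def univ_poly_carrier[symmetric])
    have FU: "F \<in> carrier (B[X])" using F univ_poly_carrier by blast
    have "eval ([b] \<otimes>\<^bsub>B[X]\<^esub> F) x = b \<otimes> f"
      using H.hom_mult[OF bU(1) FU] F bc by simp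
    also have "\<dots> = eval (S [^]\<^bsub>B[X]\<^esub> n) x"
      using f S H.hom_pow[OF SU] by simp
    finally have "[b] \<otimes>\<^bsub>B[X]\<^esub> F = S [^]\<^bsub>B[X]\<^esub> n"
      using inj_onD[OF inj] bU FU SU by simp
    then have "hd ([b] \<otimes>\<^bsub>B[X]\<^esub> F) = hd S [^] n"
      using lead_coeff_pow[OF B SU S0] by simp
    then have "b \<otimes> hd F = hd S [^] n"
      using poly_mult_lead_coeff[OF B bU(2) F(1)] F0 by (simp add: univ_poly_mult)
    then show "divides_power B (hd S) b"
      using hdB[OF F(1) F0] by (auto simp: divides_power_def)
  qed
qed

text \<open>
  Dividing the minimal equation by \<open>S\<close> leaves a remainder that is a multiple of \<open>S\<close> at \<open>x\<close>, and
  a nonzero one, since the quotient is shorter than the minimal equation and so does not vanish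
  at \<open>x\<close>.
\<close>

lemma (in domain) multiple_in_base_of_algebraic:
  assumes B: "subring B R" and x: "x \<in> carrier R"
    and P: "polynomial B P" "P \<noteq> []" "eval P x = \<zero>"
    and min: "\<And>q. polynomial B q \<Longrightarrow> length q < length P \<Longrightarrow> eval q x = \<zero> \<Longrightarrow> q = []"
    and S: "polynomial B S" "S \<noteq> []" "length S < length P"
  shows "\<exists>g\<in>simple_extension B x. g \<otimes> eval S x \<in> B - {\<zero>}"
  using S
proof (induction "length S" arbitrary: S rule: less_induct)
  case less
  let ?T = "simple_extension B x"
  have T: "subring ?T R" by (rule simple_extension_is_subring[OF B x])
  have carr: "\<And>v. v \<in> B \<Longrightarrow> v \<in> carrier R" using subringE(1)[OF B] by blast
  have setcarr: "\<And>v. set v \<subseteq> B \<Longrightarrow> set v \<subseteq> carrier R" using carr by blast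
  obtain e t where St: "S = e # t" using less.prems by (cases S) auto
  have e: "e \<in> B" "e \<noteq> \<zero>" "set t \<subseteq> B" using less.prems St by (auto simp: polynomial_def)
  have PB: "set P \<subseteq> B" "hd P \<noteq> \<zero>" using P by (auto simp: polynomial_def)
  show ?case
  \<comment> \<open>For constant \<open>S\<close> the quotient would be as long as \<open>P\<close>,
    out of reach of minimality; but then the value of \<open>S\<close> already lies in
    \<open>B\<close>.\<close>
  proof (cases "t = []")
    case True
    then show ?thesis
      using e St carr subringE(3)[OF T] by (intro bexI[of _ \<one>]) auto
  next
    case False
    obtain N :: nat and q r where qr: "set q \<subseteq> B" "set r \<subseteq> B"
      "length r = min (length P) (length t)" "length q = length P - length t"
      "e [^] N \<otimes> eval P x = eval q x \<otimes> eval (e # t) x \<oplus> eval r x"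
      "hd P \<noteq> \<zero> \<Longrightarrow> q \<noteq> [] \<Longrightarrow> hd q \<noteq> \<zero>"
      by (rule pseudo_division[OF B e x PB(1)], rule that)
    have lq: "length q < length P" "q \<noteq> []"
      using qr(4) False less.prems(3) St by (cases t; auto)+
    have qpol: "polynomial B q" using qr lq PB by (auto simp: polynomial_def)
    have c: "eval q x \<in> carrier R" "eval S x \<in> carrier R" "eval r x \<in> carrier R"
      using eval_in_carrier[OF setcarr x] qr less.prems polynomial_incl by blast+
    have q0: "eval q x \<noteq> \<zero>" using min[OF qpol lq(1)] lq(2) by blast
    have S0: "eval S x \<noteq> \<zero>" using min less.prems by blast
    have z: "eval q x \<otimes> eval S x \<oplus> eval r x = \<zero>"
      using qr(5) P(3) carr[OF e(1)] St by simp
    then have req: "eval r x = \<ominus> (eval q x \<otimes> eval S x)"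
      using c by (metis m_closed minus_equality a_comm)
    have r0: "eval r x \<noteq> \<zero>"
      using req q0 S0 c by (metis integral_iff add.inv_eq_1_iff m_closed)
    have rn: "eval (normalize r) x = eval r x" using eval_normalize setcarr qr x by blast
    have "length (normalize r) < length S"
      using normalize_length_le[of r] qr(3) St by simp
    moreover have "polynomial B (normalize r)" using normalize_gives_polynomial qr by blast
    moreover have "normalize r \<noteq> []" using r0 rn by auto
    ultimately obtain g where g: "g \<in> ?T" "g \<otimes> eval r x \<in> B - {\<zero>}"
      using less.hyps[of "normalize r"] less.prems(3) rn by (metis order.strict_trans)
    have gc: "g \<in> carrier R" using g subringE(1)[OF T] by blast
    have "\<ominus> (g \<otimes> eval q x) \<otimes> eval S x = g \<otimes> eval r x"
      unfolding req using c gc by algebra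
    moreover have "\<ominus> (g \<otimes> eval q x) \<in> ?T"
      using subringE(5,6)[OF T] g eval_in_simple_extension[OF B x qr(1)] by blast
    ultimately show ?thesis using g by metis
  qed
qed

text \<open>Choose \<open>g\<close> with \<open>c = g \<otimes> s\<close> in \<open>B\<close>, and
  let \<open>d\<close> lead a shortest equation of \<open>x\<close>. Multiplying
  \<open>b \<otimes> f = s [^] n\<close> by \<open>g [^] n\<close> and a power of \<open>d\<close>
  puts the right side into \<open>B\<close> and makes the cofactor of \<open>b\<close> a
  \<open>B\<close>-combination of low powers of \<open>x\<close>. By independence, \<open>b\<close>
  times its constant coefficient is \<open>d [^] N \<otimes> c [^] n\<close>.\<close>

lemma (in domain) power_divisors_descend_algebraic:
  assumes B: "subring B R" and x: "x \<in> carrier R" and al: "(algebraic over B) x"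
    and s: "s \<in> simple_extension B x" "s \<noteq> \<zero>"
  shows "\<exists>c\<in>B - {\<zero>}. \<forall>b\<in>B. divides_power (simple_extension B x) s b \<longrightarrow> divides_power B c b"
proof -
  let ?T = "simple_extension B x"
  note sub = subringE[OF B]
  have T: "subring ?T R" by (rule simple_extension_is_subring[OF B x])
  note subT = subringE[OF T]
  have carr: "\<And>v. v \<in> B \<Longrightarrow> v \<in> carrier R" using sub(1) by blast
  have carrT: "\<And>v. v \<in> ?T \<Longrightarrow> v \<in> carrier R" using subT(1) by blast
  have setcarr: "\<And>v. set v \<subseteq> B \<Longrightarrow> set v \<subseteq> carrier R" using carr by blast
  note powB = subring_nat_pow_closed[OF B]
  \<comment> \<open>Over the ring \<open>B\<close> there may be no monic equation for
    \<open>x\<close>; a vanishing polynomial of least length takes the place of the minimal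
    polynomial.\<close>
  define good where "good P \<longleftrightarrow> polynomial B P \<and> P \<noteq> [] \<and> eval P x = \<zero>" for P
  obtain P0 where "good P0"
    using algebraicE[OF B x al] univ_poly_carrier unfolding good_def by metis
  then obtain P where P: "good P" and least: "\<And>q. good q \<Longrightarrow> length P \<le> length q"
    using ex_has_least_nat[of good P0 length] by blast
  have Pg: "polynomial B P" "P \<noteq> []" "eval P x = \<zero>" using P by (auto simp: good_def)
  have min: "q = []" if "polynomial B q" "length q < length P" "eval q x = \<zero>" for q
    using that least[of q] unfolding good_def by auto
  have indep: "set q \<subseteq> {\<zero>}" if "set q \<subseteq> B" "length q < length P" "eval q x = \<zero>" for q
  proof (rule normalize_eq_NilD, rule min)
    show "polynomial B (normalize q)" using normalize_gives_polynomial that by blast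
    show "length (normalize q) < length P" using normalize_length_le[of q] that by simp
    show "eval (normalize q) x = \<zero>" using eval_normalize[OF setcarr[OF that(1)] x] that by simp
  qed
  obtain d t where Pt: "P = d # t" using Pg by (cases P) auto
  have d: "d \<in> B" "d \<noteq> \<zero>" "set t \<subseteq> B" using Pg Pt by (auto simp: polynomial_def)
  \<comment> \<open>Pseudo-division by \<open>P\<close> itself: the quotient term vanishes at
    \<open>x\<close>.\<close>
  have reduce: "\<exists>(N::nat) r. set r \<subseteq> B \<and> length r < length P \<and> d [^] N \<otimes> y = eval r x"
    if y: "y \<in> ?T" for y
  proof -
    obtain F where F: "polynomial B F" "y = eval F x" using simple_extensionE[OF B x y] .
    obtain N :: nat and q r where qr: "set q \<subseteq> B" "set r \<subseteq> B"
      "length r = min (length F) (length t)"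
      "d [^] N \<otimes> eval F x = eval q x \<otimes> eval (d # t) x \<oplus> eval r x"
      using pseudo_division[OF B d x polynomial_incl[OF F(1)]] by metis
    have "d [^] N \<otimes> y = eval r x"
      using qr eval_in_carrier[OF setcarr x] Pg(3) unfolding F Pt by simp
    then show ?thesis using qr Pt by (intro exI[of _ N] exI[of _ r]) auto
  qed
  \<comment> \<open>The multiplier is found for the reduced form of \<open>s\<close>; the power of
    \<open>d\<close> spent on the reduction is absorbed into \<open>g\<close>.\<close>
  obtain g where g: "g \<in> ?T" "g \<otimes> s \<in> B - {\<zero>}"
  proof -
    obtain N :: nat and r where r: "set r \<subseteq> B" "length r < length P" "d [^] N \<otimes> s = eval r x"
      using reduce[OF s(1)] by blast
    have n: "eval (normalize r) x = d [^] N \<otimes> s"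
      using eval_normalize[OF setcarr[OF r(1)] x] r by simp
    also have "\<dots> \<noteq> \<zero>" using nat_pow_nonzero[OF carr[OF d(1)] d(2)] s carrT carr d by (simp add: integral_iff)
    finally have "normalize r \<noteq> []" by auto
    moreover have "polynomial B (normalize r)" using normalize_gives_polynomial r by blast
    moreover have "length (normalize r) < length P" using normalize_length_le[of r] r by simp
    ultimately obtain h where h: "h \<in> ?T" "h \<otimes> (d [^] N \<otimes> s) \<in> B - {\<zero>}"
      using multiple_in_base_of_algebraic[OF B x Pg min, of "normalize r"] n by metis
    have dT: "d [^] N \<in> ?T" using powB[OF d(1)] simple_extension_incl[OF sub(1) x] by blast
    have "h \<otimes> d [^] N \<in> ?T" using h dT subT(6) by blast
    moreover have "h \<otimes> d [^] N \<otimes> s = h \<otimes> (d [^] N \<otimes> s)"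
      using h dT s carrT by (simp add: m_assoc)
    ultimately show thesis using that h by metis
  qed
  define c where "c = g \<otimes> s"
  have cB: "c \<in> B" "c \<noteq> \<zero>" using g by (auto simp: c_def)
  show ?thesis
  proof (rule bexI[of _ "d \<otimes> c"], intro ballI impI)
    show "d \<otimes> c \<in> B - {\<zero>}" using cB d sub(6) carr by (auto simp: integral_iff)
    fix b assume b: "b \<in> B" "divides_power ?T s b"
    then obtain n :: nat and f where f: "f \<in> ?T" "b \<otimes> f = s [^] n"
      by (auto simp: divides_power_def)
    have fg: "f \<otimes> g [^] n \<in> ?T" using f subring_nat_pow_closed[OF T g(1)] subT(6) by blast
    obtain N :: nat and r where r: "set r \<subseteq> B" "length r < length P"
      "d [^] N \<otimes> (f \<otimes> g [^] n) = eval r x"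
      using reduce[OF fg] by blast
    have cc: "b \<in> carrier R" "f \<in> carrier R" "g \<in> carrier R" "s \<in> carrier R" "d \<in> carrier R"
        "c \<in> carrier R"
      using b f g s d cB carr carrT by auto
    have "b \<otimes> eval r x = d [^] N \<otimes> ((b \<otimes> f) \<otimes> g [^] n)"
      using cc by (simp add: r(3)[symmetric] m_ac)
    also have "\<dots> = d [^] N \<otimes> c [^] n"
      using cc f by (simp add: c_def nat_pow_distrib m_ac)
    finally have br: "b \<otimes> eval r x = d [^] N \<otimes> c [^] n" .
    have "d [^] N \<otimes> c [^] n \<noteq> \<zero>" using nat_pow_nonzero cc cB d by (simp add: integral_iff)
    then have "r \<noteq> []" using br cc by auto
    then obtain r0 z where rz: "r = r0 @ [z]" by (metis rev_exhaust)
    have z: "z \<in> B" "set r0 \<subseteq> B" using r rz by auto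
    \<comment> \<open>\<open>map ((\<otimes>) b) r0 @ [w]\<close> is \<open>b\<close> times
      \<open>r\<close> with \<open>d [^] N \<otimes> c [^] n\<close> taken off the constant entry
      \<open>z\<close>. It vanishes at \<open>x\<close> and is shorter than \<open>P\<close>, so
      \<open>w\<close> is zero.\<close>
    define w where "w = b \<otimes> z \<ominus> d [^] N \<otimes> c [^] n"
    have wB: "w \<in> B"
      unfolding w_def minus_eq using b z powB[OF d(1)] powB[OF cB(1)] sub by auto
    have bx: "set (map ((\<otimes>) b) r0) \<subseteq> B" using z b sub(6) by auto
    define E where "E = eval r0 x"
    have Ec: "E \<in> carrier R" using eval_in_carrier[OF setcarr x] z by (simp add: E_def)
    have er: "eval r x = E \<otimes> x \<oplus> z"
      unfolding rz E_def using eval_append_aux setcarr z carr x by blast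
    have "eval (map ((\<otimes>) b) r0 @ [w]) x = b \<otimes> E \<otimes> x \<oplus> w"
      using eval_append_aux[OF setcarr[OF bx] carr[OF wB] x] eval_map_mult[OF setcarr[OF z(2)] _ x] cc
      by (simp add: E_def)
    also have "\<dots> = b \<otimes> eval r x \<ominus> d [^] N \<otimes> c [^] n"
    proof -
      define u where "u = d [^] N \<otimes> c [^] n"
      have "u \<in> carrier R" using cc by (simp add: u_def)
      then show ?thesis unfolding er w_def u_def[symmetric] using cc Ec x carr[OF z(1)] by algebra
    qed
    also have "\<dots> = \<zero>" using br cc by (simp add: r_right_minus_eq)
    finally have "set (map ((\<otimes>) b) r0 @ [w]) \<subseteq> {\<zero>}"
      using indep[of "map ((\<otimes>) b) r0 @ [w]"] bx wB r(2) rz by simp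
    then have "w = \<zero>" by simp
    then have bz: "b \<otimes> z = d [^] N \<otimes> c [^] n"
      using cc carr[OF z(1)] by (simp add: w_def)
    \<comment> \<open>The extra factor equalizes the exponents of \<open>d\<close> and
      \<open>c\<close>, giving a power of the single element \<open>d \<otimes> c\<close>.\<close>
    have "b \<otimes> (z \<otimes> (d [^] n \<otimes> c [^] N)) = (b \<otimes> z) \<otimes> (d [^] n \<otimes> c [^] N)"
      using cc carr[OF z(1)] by (simp add: m_assoc)
    also have "\<dots> = (d [^] N \<otimes> d [^] n) \<otimes> (c [^] N \<otimes> c [^] n)"
      unfolding bz using cc by (simp add: m_ac)
    also have "\<dots> = (d \<otimes> c) [^] (N + n)"
      using cc by (simp add: nat_pow_distrib nat_pow_mult)
    finally show "divides_power B (d \<otimes> c) b"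
      unfolding divides_power_def
      using sub(6)[OF z(1) sub(6)[OF powB[OF d(1)] powB[OF cB(1)]]] by blast
  qed
qed

lemma (in domain) power_divisors_descend:
  assumes "subring B R" "x \<in> carrier R" "s \<in> simple_extension B x" "s \<noteq> \<zero>"
  shows "\<exists>c\<in>B - {\<zero>}. \<forall>b\<in>B. divides_power (simple_extension B x) s b \<longrightarrow> divides_power B c b"
  using power_divisors_descend_transcendental power_divisors_descend_algebraic assms
  unfolding over_def by blast

text \<open>Generators are removed one at a time, and the \<open>c\<close> found for one is the
  \<open>s\<close> for the next, hence the induction over all \<open>s\<close>. Elements of
  \<open>B\<close> lie in every intermediate ring, so the implications chain.\<close>

lemma (in domain) power_divisors_descend_finite:
  assumes "subring B R" "set xs \<subseteq> carrier R" "s \<in> finite_extension B xs" "s \<noteq> \<zero>"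
  shows "\<exists>c\<in>B - {\<zero>}. \<forall>b\<in>B. divides_power (finite_extension B xs) s b \<longrightarrow> divides_power B c b"
  using assms(2-4)
proof (induction xs arbitrary: s)
  case Nil
  then show ?case by auto
next
  case (Cons x xs)
  let ?C = "finite_extension B xs"
  have C: "subring ?C R" using finite_extension_is_subring assms(1) Cons.prems by simp
  have BC: "B \<subseteq> ?C" using finite_extension_incl subringE(1)[OF assms(1)] Cons.prems by simp
  obtain c where c: "c \<in> ?C - {\<zero>}"
    "\<forall>b\<in>?C. divides_power (finite_extension B (x # xs)) s b \<longrightarrow> divides_power ?C c b"
    using power_divisors_descend[OF C, of x s] Cons.prems by auto
  then show ?case using Cons.IH[of c] Cons.prems BC by (metis DiffE insert_subset list.simps(15) singletonI subsetD)
qed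


section \<open>Invertibility of \<open>a\<close> from divisibility in \<open>K[a]\<close>\<close>

text \<open>For transcendental \<open>a\<close>, the element \<open>e\<close> would come from a unit
  of \<open>K[X]\<close>, hence a constant, forcing \<open>X\<close> times the lift of
  \<open>c\<close> to vanish. So \<open>a\<close> is algebraic, and \<open>K[a]\<close> is a field
  containing its inverse.\<close>

lemma (in domain) unit_if_simple_extension_divides_powers:
  assumes K: "subfield K R" and a: "a \<in> carrier R" "a \<noteq> \<zero>"
    and c: "c \<in> simple_extension K a - {\<zero>}"
    and all: "\<And>b. b \<in> simple_extension K a - {\<zero>} \<Longrightarrow> divides_power (simple_extension K a) c b"
  shows "a \<in> Units R"
proof -
  let ?B = "simple_extension K a"
  have Kr: "subring K R" using subfieldE(1)[OF K] .
  have B: "subring ?B R" by (rule simple_extension_is_subring[OF Kr a(1)])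
  note sub = subringE[OF B]
  have carr: "\<And>v. v \<in> ?B \<Longrightarrow> v \<in> carrier R" using sub(1) by blast
  have aB: "a \<in> ?B" by (rule simple_extension_mem[OF Kr a(1)])
  have cc: "c \<in> ?B" "c \<in> carrier R" "c \<noteq> \<zero>" using c carr by auto
  note powB = subring_nat_pow_closed[OF B cc(1)]
  define e where "e = \<one> \<oplus> a \<otimes> c"
  have eB: "e \<in> ?B" using sub aB cc by (simp add: e_def)
  have ec: "e \<in> carrier R" using eB carr by blast
  have "(algebraic over K) a"
  proof (rule ccontr)
    assume "\<not> (algebraic over K) a"
    then have tr: "(transcendental over K) a" by (simp add: over_def)
    interpret U: domain "K[X]" by (rule univ_poly_is_domain[OF Kr])
    interpret H: ring_hom_cring "K[X]" R "\<lambda>p. eval p a" by (rule eval_cring_hom[OF Kr a(1)])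
    \<comment> \<open>Evaluation at zero reads off the constant coefficient. It is one for
      \<open>?E\<close>, which shows first that \<open>?E\<close> is nonzero and later which
      constant it is.\<close>
    interpret Z: ring_hom_cring "K[X]" R "\<lambda>p. eval p \<zero>" by (rule eval_cring_hom[OF Kr zero_closed])
    have inj: "inj_on (\<lambda>p. eval p a) (carrier (K[X]))"
      using tr by (simp add: over_def transcendental_def)
    note lift = simple_extensionE[OF Kr a(1), unfolded univ_poly_carrier]
    obtain C where C: "C \<in> carrier (K[X])" "c = eval C a" using lift[OF cc(1)] .
    have X: "X \<in> carrier (K[X])" "eval X a = a" "eval X \<zero> = \<zero>"
      using var_closed(1)[OF Kr] eval_var a by auto
    have Xn: "X \<noteq> \<zero>\<^bsub>K[X]\<^esub>" using X(2) a(2) by auto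
    have C0: "C \<noteq> \<zero>\<^bsub>K[X]\<^esub>" using C(2) cc(3) by auto
    let ?E = "\<one>\<^bsub>K[X]\<^esub> \<oplus>\<^bsub>K[X]\<^esub> X \<otimes>\<^bsub>K[X]\<^esub> C"
    have E: "?E \<in> carrier (K[X])" "eval ?E a = e"
      using X C a by (simp_all add: e_def)
    have E0: "eval ?E \<zero> = \<one>" using X C by simp
    have e0: "e \<noteq> \<zero>"
    proof
      assume "e = \<zero>"
      then have "eval ?E a = eval \<zero>\<^bsub>K[X]\<^esub> a" using E by simp
      then have "?E = \<zero>\<^bsub>K[X]\<^esub>" using inj_onD[OF inj] E(1) by blast
      then show False using E0 by simp
    qed
    \<comment> \<open>Since \<open>e\<close> minus \<open>a \<otimes> c\<close> is one,
      \<open>c [^] n\<close> equals \<open>e \<otimes> c [^] n\<close> minus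
      \<open>a \<otimes> c [^] Suc n\<close>. So if \<open>e\<close> divides
      \<open>c [^] Suc n\<close>, it divides \<open>c [^] n\<close>; descend to exponent 0.\<close>
    have inv: "\<exists>h\<in>?B. e \<otimes> h = \<one>" if "\<exists>h\<in>?B. e \<otimes> h = c [^] n" for n :: nat
      using that
    proof (induction n)
      case 0
      then show ?case by simp
    next
      case (Suc n)
      then obtain h where h: "h \<in> ?B" "e \<otimes> h = c [^] n \<otimes> c" by auto
      have hc: "h \<in> carrier R" using h carr by blast
      define w where "w = c [^] n"
      have w: "w \<in> ?B" "w \<in> carrier R"
        using powB carr by (simp_all add: w_def)
      have "e \<otimes> (w \<ominus> a \<otimes> h) = e \<otimes> w \<ominus> a \<otimes> (e \<otimes> h)"
        using ec w hc a by algebra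
      also have "\<dots> = (\<one> \<oplus> a \<otimes> c) \<otimes> w \<ominus> a \<otimes> (w \<otimes> c)"
        using h(2) by (simp add: w_def e_def)
      also have "\<dots> = w" using cc w a by algebra
      finally have "e \<otimes> (w \<ominus> a \<otimes> h) = w" .
      moreover have "w \<ominus> a \<otimes> h \<in> ?B" unfolding minus_eq using w h aB sub by simp
      ultimately show ?case using Suc.IH by (auto simp: w_def)
    qed
    obtain h where h: "h \<in> ?B" "e \<otimes> h = \<one>"
      using inv all[of e] eB e0 by (auto simp: divides_power_def)
    obtain Q where Q: "Q \<in> carrier (K[X])" "h = eval Q a" using lift[OF h(1)] .
    have "eval (?E \<otimes>\<^bsub>K[X]\<^esub> Q) a = eval \<one>\<^bsub>K[X]\<^esub> a"
      using H.hom_mult[OF E(1) Q(1)] H.hom_one E(2) Q(2) h(2) by (simp only:)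
    then have "?E \<otimes>\<^bsub>K[X]\<^esub> Q = \<one>\<^bsub>K[X]\<^esub>"
      using inj_onD[OF inj] E Q by blast
    then have "?E \<in> Units (K[X])"
      using U.unit_factor[OF _ E(1) Q(1)] by simp
    then obtain k where k: "?E = [k]" "k \<in> K" using univ_poly_units[OF K] by auto
    have kc: "k \<in> carrier R" using k subringE(1)[OF Kr] by blast
    have "k = \<one>" using E0 kc unfolding k(1) by simp
    then have "?E = \<one>\<^bsub>K[X]\<^esub>" using k by (simp add: univ_poly_one)
    then have "X \<otimes>\<^bsub>K[X]\<^esub> C = \<zero>\<^bsub>K[X]\<^esub>"
      using X C by (metis U.add.l_cancel_one' U.add.r_cancel_one' U.m_closed U.one_closed U.add.m_comm)
    then show False using U.integral[OF _ X(1) C(1)] Xn C0 by blast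
  qed
  then interpret F: field "R \<lparr> carrier := ?B \<rparr>"
    using simple_extension_is_subfield[OF K a(1)] subfield_iff(2) by blast
  have "a \<in> Units (R \<lparr> carrier := ?B \<rparr>)" using F.field_Units aB a by simp
  then show ?thesis using carr by (auto simp: Units_def)
qed

section \<open>Divisors of powers of \<open>a\<close> and the localization at
  \<open>a\<close>\<close>

lemma (in domain) nilpotent_iff_zero: "nilpotent R x \<longleftrightarrow> x = \<zero>"
proof
  assume "nilpotent R x"
  then obtain n :: nat where n: "x \<in> carrier R" "x [^] n = \<zero>" by (auto simp: nilpotent_def)
  then show "x = \<zero>" using nat_pow_nonzero by blast
next
  assume "x = \<zero>"
  then show "nilpotent R x" by (auto simp: nilpotent_def intro: exI[of _ 1])
qed

text \<open>An inverse \<open>r/s\<close> gives \<open>b \<otimes> r = s\<close> after cancelling a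
  nonzero power of \<open>a\<close>, and \<open>s\<close> is itself a power of \<open>a\<close>.
  Conversely, a cofactor \<open>g\<close> for \<open>a [^] n\<close> gives the inverse
  \<open>g / a [^] n\<close>.\<close>

lemma (in domain) frac_unit_iff:
  fixes a
  defines "S \<equiv> {a [^] n |n::nat. True}"
  assumes a: "a \<in> carrier R" "a \<noteq> \<zero>" and b: "b \<in> carrier R"
  shows "loc_frac R S b \<one> \<in> Units (localization R S) \<longleftrightarrow> divides_power (carrier R) a b"
proof -
  interpret multiplicative_set R S unfolding S_def by (rule multiplicative_set_powers[OF a(1)])
  interpret L: cring "localization R S" by (rule localization_cring)
  have S0: "t \<noteq> \<zero>" if "t \<in> S" for t
    using that nat_pow_nonzero[OF a] by (auto simp: S_def)
  show ?thesis
  proof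
    assume "loc_frac R S b \<one> \<in> Units (localization R S)"
    then obtain Q where Q: "Q \<in> carrier (localization R S)"
      "loc_frac R S b \<one> \<otimes>\<^bsub>localization R S\<^esub> Q = \<one>\<^bsub>localization R S\<^esub>"
      by (auto simp: Units_def)
    obtain r s where rs: "r \<in> carrier R" "s \<in> S" "Q = loc_frac R S r s"
      using frac_cases[OF Q(1)] .
    have "loc_frac R S (b \<otimes> r) s = loc_frac R S \<one> \<one>"
      using Q(2) rs b S_one by (simp add: frac_mult frac_one)
    then obtain t where t: "t \<in> S" "t \<otimes> (b \<otimes> r) = t \<otimes> s"
      using rs b S_one by (auto simp: frac_eq_iff)
    then have "b \<otimes> r = s" using S0 m_lcancel rs b by (metis S_carr m_closed)
    then show "divides_power (carrier R) a b"
      using rs by (auto simp: divides_power_def S_def)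
  next
    assume "divides_power (carrier R) a b"
    then obtain n :: nat and g where g: "g \<in> carrier R" "b \<otimes> g = a [^] n"
      by (auto simp: divides_power_def)
    have s: "a [^] n \<in> S" by (auto simp: S_def)
    have "loc_frac R S b \<one> \<otimes>\<^bsub>localization R S\<^esub> loc_frac R S g (a [^] n) = \<one>\<^bsub>localization R S\<^esub>"
      using b g s S_one a by (simp add: frac_mult frac_one) (rule frac_eqI, auto)
    moreover have "loc_frac R S g (a [^] n) \<in> carrier (localization R S)"
      "loc_frac R S b \<one> \<in> carrier (localization R S)"
      using b g s S_one by auto
    ultimately show "loc_frac R S b \<one> \<in> Units (localization R S)"
      using L.m_comm unfolding Units_def by (metis (mono_tags, lifting) mem_Collect_eq)
  qed
qed

text \<open>Unit-additivity enters here: the two fractions are units, so their sum is a unit or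
  nilpotent, and over a domain a nilpotent fraction has numerator zero.\<close>

lemma (in domain) divides_power_add:
  assumes ua: "unit_additive (localization_at_elem R a)"
    and a: "a \<in> carrier R" "a \<noteq> \<zero>" and bc: "b \<in> carrier R" "c \<in> carrier R"
    and d: "divides_power (carrier R) a b" "divides_power (carrier R) a c"
  shows "b \<oplus> c = \<zero> \<or> divides_power (carrier R) a (b \<oplus> c)"
proof -
  define S where "S = {a [^] n |n::nat. True}"
  interpret multiplicative_set R S unfolding S_def by (rule multiplicative_set_powers[OF a(1)])
  let ?L = "localization R S"
  interpret L: cring ?L by (rule localization_cring)
  have unit: "loc_frac R S x \<one> \<in> Units ?L \<longleftrightarrow> divides_power (carrier R) a x" if "x \<in> carrier R" for x
    unfolding S_def by (rule frac_unit_iff[OF a that])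
  have sum: "loc_frac R S b \<one> \<oplus>\<^bsub>?L\<^esub> loc_frac R S c \<one> = loc_frac R S (b \<oplus> c) \<one>"
    using bc S_one by (simp add: frac_add)
  have S0: "t \<noteq> \<zero>" if "t \<in> S" for t
    using that nat_pow_nonzero[OF a] by (auto simp: S_def)
  have "loc_frac R S (b \<oplus> c) \<one> \<in> Units ?L \<or> nilpotent ?L (loc_frac R S (b \<oplus> c) \<one>)"
    using ua d bc unit sum unfolding unit_additive_def localization_at_elem_def S_def[symmetric] by metis
  then show ?thesis
  proof
    assume "nilpotent ?L (loc_frac R S (b \<oplus> c) \<one>)"
    then obtain n :: nat where n: "loc_frac R S (b \<oplus> c) \<one> [^]\<^bsub>?L\<^esub> n = \<zero>\<^bsub>?L\<^esub>"
      by (auto simp: nilpotent_def)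
    define z where "z = b \<oplus> c"
    have z: "z \<in> carrier R" using bc by (simp add: z_def)
    have "loc_frac R S z \<one> [^]\<^bsub>?L\<^esub> n = loc_frac R S (z [^] n) \<one>" for n :: nat
      using z S_one by (induction n) (auto simp: frac_one frac_mult)
    then have "loc_frac R S (z [^] n) \<one> = loc_frac R S \<zero> \<one>"
      using n by (simp add: z_def frac_zero)
    then obtain t where "t \<in> S" "t \<otimes> z [^] n = \<zero>"
      using z S_one by (auto simp: frac_eq_iff)
    then have "z [^] n = \<zero>" using S0 z by (auto simp: integral_iff)
    then have "z = \<zero>" using nat_pow_nonzero z by blast
    then show ?thesis by (simp add: z_def)
  qed (use unit bc in auto)
qed

text \<open>This set is the preimage in \<open>R\<close> of zero and the units of the localization.
  Sums come from unit-additivity, products from multiplying cofactors.\<close>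

lemma (in domain) zero_or_divides_power_subring:
  assumes ua: "unit_additive (localization_at_elem R a)" and a: "a \<in> carrier R" "a \<noteq> \<zero>"
  shows "subring {b \<in> carrier R. b = \<zero> \<or> divides_power (carrier R) a b} R"
proof (rule subringI)
  fix b assume b: "b \<in> {b \<in> carrier R. b = \<zero> \<or> divides_power (carrier R) a b}"
  have "divides_power (carrier R) a (\<ominus> b)" if h: "divides_power (carrier R) a b"
  proof -
    obtain n :: nat and g where g: "g \<in> carrier R" "b \<otimes> g = a [^] n"
      using h by (auto simp: divides_power_def)
    then have "\<ominus> b \<otimes> \<ominus> g = a [^] n" using b a by (simp add: l_minus r_minus)
    then show ?thesis using g by (auto simp: divides_power_def)
  qed
  then show "\<ominus> b \<in> {b \<in> carrier R. b = \<zero> \<or> divides_power (carrier R) a b}" using b by auto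
  fix c assume c: "c \<in> {b \<in> carrier R. b = \<zero> \<or> divides_power (carrier R) a b}"
  have "divides_power (carrier R) a (b \<otimes> c)"
    if h: "divides_power (carrier R) a b" "divides_power (carrier R) a c"
  proof -
    obtain n m :: nat and g h where g: "g \<in> carrier R" "b \<otimes> g = a [^] n" "h \<in> carrier R" "c \<otimes> h = a [^] m"
      using h by (auto simp: divides_power_def)
    have "b \<otimes> c \<otimes> (g \<otimes> h) = (b \<otimes> g) \<otimes> (c \<otimes> h)" using b c g(1,3) by (simp add: m_ac)
    also have "\<dots> = a [^] (n + m)" using g a by (simp add: nat_pow_mult)
    finally show ?thesis using g by (auto simp: divides_power_def)
  qed
  then show "b \<otimes> c \<in> {b \<in> carrier R. b = \<zero> \<or> divides_power (carrier R) a b}" using b c by auto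
  show "b \<oplus> c \<in> {b \<in> carrier R. b = \<zero> \<or> divides_power (carrier R) a b}"
    using b c divides_power_add[OF ua a] by auto
qed (auto simp: divides_power_def intro!: exI[of _ "0::nat"])

section \<open>The finitely generated algebra\<close>

lemma algebra_image_subfield:
  assumes k: "field k" and R: "domain R" and alg: "algebra k R"
  shows "subfield ((\<lambda>c. c \<odot>\<^bsub>R\<^esub> \<one>\<^bsub>R\<^esub>) ` carrier k) R"
proof -
  interpret domain R by fact
  interpret k: field k by fact
  interpret A: algebra k R by fact
  interpret h: ring_hom_ring k R "\<lambda>c. c \<odot>\<^bsub>R\<^esub> \<one>\<^bsub>R\<^esub>"
    by unfold_locales
      (auto intro!: ring_hom_memI simp: A.smult_l_distr A.smult_assoc1 A.smult_assoc2)
  show ?thesis by (rule h.img_is_subfield(2)[OF k.carrier_is_subfield one_not_zero])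
qed

theorem proposition3p18:
  fixes k :: "('k, 'l) ring_scheme" and R :: "('k, 'a, 'm) module_scheme"
  assumes "field k"
    and "domain R"
    and "finitely_generated_algebra k R"
    and "generically_unit_additive R"
  shows "unit_additive R"
proof -
  interpret domain R by fact
  let ?K = "(\<lambda>c. c \<odot>\<^bsub>R\<^esub> \<one>\<^bsub>R\<^esub>) ` carrier k"
  obtain G where alg: "algebra k R" and G: "finite G" "G \<subseteq> carrier R"
    "generate_ring R (?K \<union> G) = carrier R"
    using assms(3) by (auto simp: finitely_generated_algebra_def)
  obtain a where a: "a \<in> carrier R" "a \<noteq> \<zero>\<^bsub>R\<^esub>" and ua: "unit_additive (localization_at_elem R a)"
    using assms(4) by (auto simp: generically_unit_additive_def)
  have K: "subfield ?K R" by (rule algebra_image_subfield[OF assms(1,2) alg])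
  have Kr: "subring ?K R" by (rule subfieldE(1)[OF K])
  have Kc: "?K \<subseteq> carrier R" by (rule subringE(1)[OF Kr])
  define D where "D = {b \<in> carrier R. b = \<zero>\<^bsub>R\<^esub> \<or> divides_power (carrier R) a b}"
  have D: "subring D R" unfolding D_def by (rule zero_or_divides_power_subring[OF ua a])
  have unitD: "u \<in> D" if u: "u \<in> Units R" for u
  proof -
    have "u \<otimes>\<^bsub>R\<^esub> inv\<^bsub>R\<^esub> u = a [^]\<^bsub>R\<^esub> (0::nat)" using u by simp
    then show ?thesis using u unfolding D_def divides_power_def by blast
  qed
  have KD: "?K \<subseteq> D"
  proof
    fix v assume v: "v \<in> ?K"
    show "v \<in> D"
    proof (cases "v = \<zero>\<^bsub>R\<^esub>")
      case False
      then have "v \<in> Units R" using subfield_m_inv[OF K, of v] v Kc by (auto simp: Units_def)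
      then show ?thesis by (rule unitD)
    qed (simp add: D_def)
  qed
  have aD: "a \<in> D"
    using a by (auto simp: D_def divides_power_def intro!: exI[of _ "1::nat"] bexI[of _ "\<one>\<^bsub>R\<^esub>"])
  let ?B = "simple_extension ?K a"
  have B: "subring ?B R" by (rule simple_extension_is_subring[OF Kr a(1)])
  have BD: "?B \<subseteq> D" by (rule simple_extension_subring_incl[OF D KD aD])
  obtain xs where xs: "set xs = G" using finite_list[OF G(1)] by blast
  have xc: "set xs \<subseteq> carrier R" using xs G by simp
  \<comment> \<open>The generators are adjoined to \<open>K[a]\<close> rather than to
    \<open>?K\<close>, so that the descent ends at \<open>K[a]\<close>.\<close>
  let ?T = "finite_extension ?B xs"
  have T: "subring ?T R" by (rule finite_extension_is_subring[OF B xc])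
  have "?K \<subseteq> ?T"
    using simple_extension_incl[OF Kc a(1)] finite_extension_incl[OF subringE(1)[OF B] xc] by blast
  then have "carrier R \<subseteq> ?T"
    using generate_ring_min_subring1[of "?K \<union> G" ?T] T finite_extension_mem[OF B xc] Kc G xs
    by (metis Un_least)
  then have TR: "?T = carrier R" using subringE(1)[OF T] by blast
  \<comment> \<open>Nonzero elements of \<open>K[a]\<close> lie in \<open>D\<close>, so they divide
    powers of \<open>a\<close> in \<open>R\<close>; the descent turns this into dividing powers of
    \<open>c\<close> inside \<open>K[a]\<close>.\<close>
  obtain c where c: "c \<in> ?B - {\<zero>\<^bsub>R\<^esub>}"
    "\<forall>b\<in>?B. divides_power ?T a b \<longrightarrow> divides_power ?B c b"
    using power_divisors_descend_finite[OF B xc, of a] a unfolding TR by blast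
  have "divides_power ?B c b" if "b \<in> ?B - {\<zero>\<^bsub>R\<^esub>}" for b
    using that c(2) BD unfolding TR by (auto simp: D_def)
  then have aU: "a \<in> Units R" by (rule unit_if_simple_extension_divides_powers[OF K a c(1)])
  \<comment> \<open>With \<open>a\<close> invertible, divisors of its powers are units. So
    \<open>D\<close> consists of zero and the units of \<open>R\<close>, and being a subring it
    contains the sum of two units.\<close>
  have Dunit: "b \<in> Units R" if b: "b \<in> D" "b \<noteq> \<zero>\<^bsub>R\<^esub>" for b
  proof -
    obtain n :: nat and g where g: "b \<in> carrier R" "g \<in> carrier R" "b \<otimes>\<^bsub>R\<^esub> g = a [^]\<^bsub>R\<^esub> n"
      using b by (auto simp: D_def divides_power_def)
    have "a [^]\<^bsub>R\<^esub> n \<in> Units R" using aU by (induction n) auto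
    then show ?thesis using g unit_factor[of b g] by simp
  qed
  show ?thesis
    unfolding unit_additive_def nilpotent_iff_zero
    using is_cring unitD subringE(7)[OF D] Dunit by metis
qed

end
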